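(* Let $d\ge 1$, let $k_1,\dots,k_d\ge 1$ be integers, let $m_1\ge 1$ and $m_2,\dots,m_d\ge 0$ be integers, and let $G=0^{m_1}\,k_1\,0^{m_2}\,k_2\,\ldots\,0^{m_d}\,k_d$ be the corresponding threshold hypergraph. Then the eigenvalues of the Laplacian $L_G$ are as follows: (i) $0$ with multiplicity $1$; (ii) $d-i+1$ with multiplicity $m_i$, for each $i=2,\ldots,d$; (iii) $d$ with multiplicity $m_1-1$; (iv) $\frac{1}{k_i}\left(\sum_{j=1}^i m_j+\sum_{j=1}^i k_j\right)+d-i$ with multiplicity $1$, for each $i=1,\ldots,d$; (v) $\frac{k_i+1}{k_i}\left(\sum_{j=1}^i m_j+\sum_{j=1}^{i-1} k_j\right)+d-i$ with multiplicity $k_i-1$, for each $i=1,\ldots,d$.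
   Context: A (finite) hypergraph $G=(V,E)$ consists of a nonempty finite vertex set $V$ and a set $E$ of subsets of $V$ (hyperedges), with $|e|\ge 2$ for all $e\in E$. For $v\in V$ let $E_v=\{e\in E: v\in e\}$. The Laplacian $L_G:\mathbb{R}^V\to\mathbb{R}^V$ is $$(L_Gf)(v)=\sum_{e\in E_v}\frac{1}{|e|-1}\sum_{u\in e}\bigl(f(v)-f(u)\bigr),\qquad v\in V.$$ For a positive integer $k$, applying $k$-domination to a hypergraph $(V,E)$ means adding a set $S$ of $k$ new vertices ($S\cap V=\emptyset$), producing the hypergraph with vertex set $V\cup S$ and hyperedge set $E\cup\{S\cup\{v\}: v\in V\}$. Adding an isolated vertex means adding one new vertex to the vertex set without changing the hyperedge set. A threshold hypergraph is a hypergraph obtained from a single vertex by repeatedly (any number of times, in any order) adding an isolated vertex or applying $k$-domination for some positive integer $k$ ($k$ may vary from step to step). The string $0^{m_1}\,k_1\,0^{m_2}\,k_2\,\ldots\,0^{m_d}\,k_d$ denotes the (connected) threshold hypergraph built from left to right: start with $m_1$ isolated vertices (the first being the initial vertex), apply $k_1$-domination, add $m_2$ isolated vertices, apply $k_2$-domination, and so on, ending with $k_d$-domination. The list of eigenvalues is to be read as a multiset: equal values occurring in different items have their multiplicities added, and multiplicity $0$ means the value is not contributed by that item. *)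

theory Defs
  imports Complex_Main "HOL-Library.Multiset" "HOL-Library.Function_Algebras"
begin

section \<open>Hypergraphs and their Laplacian\<close>

type_synonym 'a hypergraph = "'a set \<times> 'a set set"

definition hypergraph :: "'a hypergraph \<Rightarrow> bool" where
  "hypergraph G \<longleftrightarrow> finite (fst G) \<and> fst G \<noteq> {} \<and> (\<forall>e\<in>snd G. e \<subseteq> fst G \<and> 2 \<le> card e)"

definition laplacian :: "'a hypergraph \<Rightarrow> ('a \<Rightarrow> real) \<Rightarrow> 'a \<Rightarrow> real" where
  "laplacian G f v =
     (\<Sum>e\<in>{e \<in> snd G. v \<in> e}. 1 / (real (card e) - 1) * (\<Sum>u\<in>e. f v - f u))"

text \<open>
  The space of real functions on a vertex set \<open>V\<close> is modelled by the functions on the whole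
  type that vanish outside \<open>V\<close>.  For a hypergraph with vertex set \<open>V\<close> the Laplacian maps this
  space to itself, because no hyperedge contains a vertex outside \<open>V\<close>.
\<close>

definition functions_on :: "'a set \<Rightarrow> ('a \<Rightarrow> real) set" where
  "functions_on V = {f. \<forall>v. v \<notin> V \<longrightarrow> f v = 0}"

lemma laplacian_functions_on:
  assumes "hypergraph G"
  shows "laplacian G f \<in> functions_on (fst G)"
proof -
  have "laplacian G f v = 0" if "v \<notin> fst G" for v
  proof -
    have "{e \<in> snd G. v \<in> e} = {}" using assms that by (auto simp: hypergraph_def)
    then show ?thesis unfolding laplacian_def by (simp only: sum.empty)
  qed
  then show ?thesis by (simp add: functions_on_def)
qed

definition fun_scale :: "real \<Rightarrow> ('a \<Rightarrow> real) \<Rightarrow> 'a \<Rightarrow> real" where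
  "fun_scale c f = (\<lambda>v. c * f v)"

lemma vector_space_fun_scale: "vector_space (fun_scale :: real \<Rightarrow> ('a \<Rightarrow> real) \<Rightarrow> _)"
  by unfold_locales (auto simp: fun_scale_def fun_eq_iff algebra_simps)

definition laplacian_eigenspace :: "'a hypergraph \<Rightarrow> real \<Rightarrow> ('a \<Rightarrow> real) set" where
  "laplacian_eigenspace G \<mu> = {f \<in> functions_on (fst G). laplacian G f = fun_scale \<mu> f}"

text \<open>
  The Laplacian is self-adjoint, so the dimension of the eigenspace is the multiplicity of \<open>\<mu>\<close>
  in every sense; it is \<open>0\<close> exactly if \<open>\<mu>\<close> is not an eigenvalue.
\<close>

definition laplacian_multiplicity :: "'a hypergraph \<Rightarrow> real \<Rightarrow> nat" where
  "laplacian_multiplicity G \<mu> = vector_space.dim fun_scale (laplacian_eigenspace G \<mu>)"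


section \<open>Threshold hypergraphs\<close>

datatype threshold_symbol = Isolated | Dominate nat

text \<open>
  \<open>threshold_build w G\<close>: the hypergraph \<open>G\<close> arises by reading \<open>w\<close> from left to right.  The first
  symbol is always \<open>Isolated\<close> and stands for the initial vertex.  The new vertices are
  arbitrary, so \<open>w\<close> determines \<open>G\<close> up to isomorphism.
\<close>

inductive threshold_build :: "threshold_symbol list \<Rightarrow> 'a hypergraph \<Rightarrow> bool" where
  initial: "threshold_build [Isolated] ({v}, {})"
| isolated: "threshold_build w (V, E) \<Longrightarrow> v \<notin> V
    \<Longrightarrow> threshold_build (w @ [Isolated]) (V \<union> {v}, E)"
| dominate: "threshold_build w (V, E) \<Longrightarrow> finite S \<Longrightarrow> card S = k \<Longrightarrow> 1 \<le> k \<Longrightarrow> S \<inter> V = {}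
    \<Longrightarrow> threshold_build (w @ [Dominate k]) (V \<union> S, E \<union> {S \<union> {v} | v. v \<in> V})"

lemma threshold_build_hypergraph: "threshold_build w G \<Longrightarrow> hypergraph G"
proof (induction rule: threshold_build.induct)
  case (dominate w V E S k)
  have "2 \<le> card (S \<union> {v})" if "v \<in> V" for v
    using dominate that by (subst card_Un_disjoint) auto
  with dominate show ?case by (auto simp: hypergraph_def)
qed (auto simp: hypergraph_def)

lemma threshold_build_exists:
  assumes "infinite (UNIV :: 'a set)" and "\<forall>k. Dominate k \<in> set w \<longrightarrow> 1 \<le> k"
  shows "\<exists>G :: 'a hypergraph. threshold_build (Isolated # w) G"
  using assms(2)
proof (induction w rule: rev_induct)
  case Nil
  show ?case using threshold_build.initial[of undefined] by blast
next
  case (snoc x w)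
  then obtain V :: "'a set" and E where G: "threshold_build (Isolated # w) (V, E)" by auto
  then have "finite V" using threshold_build_hypergraph by (fastforce simp: hypergraph_def)
  then have inf: "infinite (- V)" using assms(1) by (simp add: Compl_eq_Diff_UNIV)
  show ?case
  proof (cases x)
    case Isolated
    obtain v where "v \<notin> V" using inf by (metis Compl_iff finite.emptyI subsetI subset_empty)
    from threshold_build.isolated[OF G this] show ?thesis using Isolated by auto
  next
    case (Dominate k)
    obtain S where "finite S" "card S = k" "S \<subseteq> - V"
      using infinite_arbitrarily_large[OF inf] by blast
    then show ?thesis
      using threshold_build.dominate[OF G, of S k] snoc.prems Dominate by auto
  qed
qed

text \<open>
  The sequences \<open>m\<close> and \<open>k\<close> are indexed from \<open>1\<close>; the value at \<open>0\<close> and those beyond \<open>d\<close> are not used.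
\<close>

definition threshold_string ::
    "nat \<Rightarrow> (nat \<Rightarrow> nat) \<Rightarrow> (nat \<Rightarrow> nat) \<Rightarrow> threshold_symbol list" where
  "threshold_string d m k =
     concat (map (\<lambda>i. replicate (m i) Isolated @ [Dominate (k i)]) [1..<d + 1])"

end

theory Submission
  imports Defs "HOL-Library.Indicator_Function"
begin

text \<open>
  Constant functions always lie in the kernel of the Laplacian, and on their orthogonal
  complement, the functions of sum zero, each building step acts in a simple way. If a set \<open>S\<close> of
  \<open>k\<close> vertices is added to a hypergraph on \<open>n\<close> vertices \<open>V\<close>, the functions of sum zero on
  \<open>V \<union> S\<close> are spanned by those on \<open>V\<close>, those on \<open>S\<close> and one further
  function \<open>b\<close> with the value \<open>k\<close> on \<open>V\<close> and \<open>-n\<close> on \<open>S\<close>. Domination by \<open>S\<close> does the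
  following to these three parts (\<open>laplacian_dominate\<close>).

  \<^item> On a function supported on \<open>V\<close> with sum zero the new hyperedges add the identity to the
    Laplacian: each \<open>v\<close> in \<open>V\<close> lies in just one of them, whose other vertices carry the value
    \<open>0\<close>, while on \<open>S\<close> the contributions cancel. So old eigenvalues grow by \<open>1\<close>.
  \<^item> A function supported on \<open>S\<close> with sum zero is an eigenfunction for \<open>n (k + 1) / k\<close>; this
    space has dimension \<open>k - 1\<close>.
  \<^item> The function \<open>b\<close> is an eigenfunction for \<open>(n + k) / k\<close>.

  Adding an isolated vertex changes no hyperedge, and the function \<open>b\<close> of \<open>S = {v}\<close> gives a new
  eigenvalue \<open>0\<close>. Following an eigenvalue from the step in which it appears to the end of
  the string yields the list: it grows by \<open>1\<close> for every later domination
  (\<open>threshold_spectrum_Suc\<close>).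

  The eigenfunctions are collected as a multiset of pairs \<open>(f, \<mu>)\<close> with one pair less than there
  are vertices. Only the size of this multiset and the fact that it spans have to be
  maintained along a building sequence. Linear independence then comes for free from a
  dimension count (\<open>laplacian_multiplicity_eq_count\<close>).
\<close>

section \<open>Functions on a finite vertex set\<close>

interpretation fun_space: vector_space "fun_scale :: real \<Rightarrow> ('a \<Rightarrow> real) \<Rightarrow> _"
  by (rule vector_space_fun_scale)

interpretation fun_space_pair: vector_space_pair
    "fun_scale :: real \<Rightarrow> ('a \<Rightarrow> real) \<Rightarrow> _" "fun_scale :: real \<Rightarrow> ('a \<Rightarrow> real) \<Rightarrow> _"
  by unfold_locales

lemma fun_scale_apply [simp]: "fun_scale c f v = c * f v"
  by (simp add: fun_scale_def)

lemma sum_fun_apply: "(\<Sum>i\<in>I. g i) v = (\<Sum>i\<in>I. g i v)"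
  for g :: "'b \<Rightarrow> 'a \<Rightarrow> real"
  by (induction I rule: infinite_finite_induct) auto

lemma dim_functions_on:
  assumes "finite V"
  shows "fun_space.dim (functions_on V) = card V"
proof -
  define e :: "'a \<Rightarrow> 'a \<Rightarrow> real" where "e = (\<lambda>v. indicator {v})"
  have inj: "inj e"
    by (auto simp: inj_def e_def fun_eq_iff indicator_def split: if_splits)
  have "functions_on V \<subseteq> fun_space.span (e ` V)"
  proof
    fix f :: "'a \<Rightarrow> real"
    assume "f \<in> functions_on V"
    moreover have "f v * e v x = (if v = x then f v else 0)" for v x
      by (simp add: e_def)
    ultimately have "f = (\<Sum>v\<in>V. fun_scale (f v) (e v))"
      using assms by (auto simp: fun_eq_iff sum_fun_apply functions_on_def sum.delta)
    then show "f \<in> fun_space.span (e ` V)"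
      by (metis (no_types, lifting) fun_space.span_base fun_space.span_scale fun_space.span_sum
          imageI)
  qed
  moreover have "fun_space.independent (e ` V)"
  proof (subst fun_space.independent_explicit_finite_subsets, intro allI impI ballI)
    fix A u a
    assume A: "A \<subseteq> e ` V" "finite A" "(\<Sum>a\<in>A. fun_scale (u a) a) = 0" "a \<in> A"
    then obtain v where v: "a = e v" by auto
    have "u b * b v = (if b = a then u a else 0)" if "b \<in> A" for b
      using that A(1) v by (auto simp: e_def indicator_def)
    then have "(\<Sum>b\<in>A. u b * b v) = u a"
      using A(2,4) by (simp add: sum.delta)
    moreover have "(\<Sum>b\<in>A. u b * b v) = 0"
      using fun_cong[OF A(3), of v] by (simp add: sum_fun_apply)
    ultimately show "u a = 0" by simp
  qed
  moreover have "e ` V \<subseteq> functions_on V"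
    by (auto simp: e_def functions_on_def indicator_def)
  ultimately have "fun_space.dim (functions_on V) = card (e ` V)"
    by (intro fun_space.dim_unique[of "e ` V"]) auto
  then show ?thesis
    using inj by (simp add: card_image inj_on_subset)
qed

section \<open>Multiplicities from a spanning family of eigenfunctions\<close>

lemma linear_laplacian: "Vector_Spaces.linear fun_scale fun_scale (laplacian G)"
proof (unfold Vector_Spaces.linear_iff, intro conjI allI vector_space_fun_scale)
  fix f g :: "'a \<Rightarrow> real" and c :: real
  show "laplacian G (f + g) = laplacian G f + laplacian G g"
    by (simp add: fun_eq_iff laplacian_def add_diff_add sum.distrib add_divide_distrib)
  have "(\<Sum>u\<in>e. c * f v - c * f u) = c * (\<Sum>u\<in>e. f v - f u)" for e v
    by (simp only: sum_distrib_left right_diff_distrib)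
  then show "laplacian G (fun_scale c f) = fun_scale c (laplacian G f)"
    unfolding laplacian_def fun_eq_iff fun_scale_apply
    by (simp only:) (simp add: sum_distrib_left mult.left_commute del: times_divide_eq_left)
qed

lemma spanning_independent_if_card_eq_dim:
  assumes "finite B" "B \<subseteq> fun_space.span U" "U \<subseteq> fun_space.span B" "card B \<le> fun_space.dim U"
  shows "fun_space.independent B"
proof -
  obtain C where C: "C \<subseteq> B" "fun_space.independent C" "B \<subseteq> fun_space.span C"
    using fun_space.maximal_independent_subset by blast
  have "U \<subseteq> fun_space.span C"
    using assms(3) C(3) by (meson fun_space.span_minimal fun_space.subspace_span subset_trans)
  then have "fun_space.dim U \<le> card C"
    using C(1) assms(1) finite_subset fun_space.dim_le_card by blast
  then have "C = B"
    using C(1) assms(1,4) by (metis card_mono card_subset_eq le_antisym le_trans)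
  then show ?thesis using C(2) by simp
qed

text \<open>
  As many eigenfunctions as vertices that span form a basis, and no
  function occurs twice among them. Expanding an eigenfunction for \<open>\<mu>\<close> in this basis and
  comparing coefficients shows that only members with eigenvalue \<open>\<mu>\<close> occur, so these are a basis
  of the eigenspace.
\<close>

lemma laplacian_multiplicity_eq_count:
  assumes fin: "finite (fst G)"
    and size: "size N = card (fst G)"
    and span: "functions_on (fst G) \<subseteq> fun_space.span (fst ` set_mset N)"
    and eigen: "\<And>f \<mu>. (f, \<mu>) \<in># N \<Longrightarrow> f \<in> functions_on (fst G) \<and> laplacian G f = fun_scale \<mu> f"
  shows "laplacian_multiplicity G = count (image_mset snd N)"
proof
  fix \<mu> :: real
  define A where "A = set_mset N"
  have finA: "finite A" by (simp add: A_def)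
  have cards: "card (fst ` A) \<le> card A" "card A \<le> size N"
    using card_image_le[OF finA] size_mset_mono[OF mset_set_set_mset_msubset[of N]]
    by (simp_all add: A_def)
  have sub: "fst ` A \<subseteq> functions_on (fst G)"
    using eigen by (auto simp: A_def)
  have "card (fst G) \<le> card (fst ` A)"
    using fun_space.dim_le_card[OF span] dim_functions_on[OF fin] by (simp add: A_def)
  then have eq: "card (fst ` A) = card A" "card A = size N"
    using cards size by simp_all
  have inj: "inj_on fst A"
    using eq(1) finA by (simp add: eq_card_imp_inj_on)
  have "mset_set A = N"
    using eq(2) mset_set_set_mset_msubset[of N] mset_subset_size[of "mset_set A" N]
    by (auto simp: A_def subset_mset.le_less)
  have indep: "fun_space.independent (fst ` A)"
    using sub span finA eq size dim_functions_on[OF fin]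
    by (intro spanning_independent_if_card_eq_dim[of _ "functions_on (fst G)"])
       (auto simp: A_def intro: fun_space.span_base)
  define B where "B = {f. (f, \<mu>) \<in> A}"
  have B: "B \<subseteq> laplacian_eigenspace G \<mu>"
    using eigen by (auto simp: B_def A_def laplacian_eigenspace_def)
  have "laplacian_eigenspace G \<mu> \<subseteq> fun_space.span B"
  proof
    fix f
    assume "f \<in> laplacian_eigenspace G \<mu>"
    then have f: "f \<in> functions_on (fst G)" "laplacian G f = fun_scale \<mu> f"
      by (auto simp: laplacian_eigenspace_def)
    obtain c where c: "f = (\<Sum>b\<in>fst ` A. fun_scale (c b) b)"
      using f(1) span finA by (auto simp: A_def fun_space.span_finite)
    have f_eq: "f = (\<Sum>p\<in>A. fun_scale (c (fst p)) (fst p))"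
      unfolding c by (simp add: sum.reindex[OF inj])
    have L: "laplacian G (fst p) = fun_scale (snd p) (fst p)" if "p \<in> A" for p
      using eigen[of "fst p" "snd p"] that by (simp add: A_def)
    have "laplacian G f = (\<Sum>p\<in>A. fun_scale (c (fst p) * snd p) (fst p))"
      by (subst f_eq)
         (simp add: fun_space_pair.linear_sum[OF linear_laplacian]
           fun_space_pair.linear_scale[OF linear_laplacian] L)
    moreover have "fun_scale \<mu> f = (\<Sum>p\<in>A. fun_scale (c (fst p) * \<mu>) (fst p))"
      by (subst f_eq) (simp add: fun_space.scale_sum_right mult.commute)
    ultimately have "(\<Sum>p\<in>A. fun_scale (c (fst p) * (snd p - \<mu>)) (fst p)) = 0"
      using f(2) by (simp add: algebra_simps fun_space.scale_left_diff_distrib sum_subtractf)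
    \<comment> \<open>Since \<open>fst\<close> is injective on \<open>A\<close>, the eigenvalue of a basis member \<open>b\<close> is
      \<open>snd (inv_into A fst b)\<close>.\<close>
    then have "(\<Sum>b\<in>fst ` A. fun_scale (c b * (snd (inv_into A fst b) - \<mu>)) b) = 0"
      by (simp add: sum.reindex[OF inj] inj)
    with finA have zero: "c b * (snd (inv_into A fst b) - \<mu>) = 0" if "b \<in> fst ` A" for b
      using that finA
      by (intro fun_space.independentD[OF indep _ subset_refl,
          where u = "\<lambda>b. c b * (snd (inv_into A fst b) - \<mu>)"]) auto
    have "fun_scale (c (fst p)) (fst p) \<in> fun_space.span B" if "p \<in> A" for p
    proof (cases "snd p = \<mu>")
      case True
      then have "fst p \<in> B"
        using that by (auto simp: B_def)
      then show ?thesis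
        by (intro fun_space.span_scale fun_space.span_base)
    next
      case False
      then have "c (fst p) = 0"
        using zero[of "fst p"] that inj by auto
      then show ?thesis by (simp add: fun_space.span_zero)
    qed
    then show "f \<in> fun_space.span B"
      by (subst f_eq) (auto intro: fun_space.span_sum)
  qed
  moreover have "fun_space.independent B"
    using indep by (rule fun_space.independent_mono) (force simp: B_def)
  ultimately have "laplacian_multiplicity G \<mu> = card B"
    unfolding laplacian_multiplicity_def
    using B by (intro fun_space.dim_unique[of B]) auto
  also have "B = fst ` {p \<in> A. snd p = \<mu>}"
    by (force simp: B_def)
  also have "card \<dots> = card {p \<in> A. snd p = \<mu>}"
    using inj by (intro card_image) (auto intro: inj_on_subset)
  also have "\<dots> = count (image_mset snd (mset_set A)) \<mu>"
    using finA by (simp add: count_image_mset count_mset_set Int_def vimage_def conj_commute)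
  finally show "laplacian_multiplicity G \<mu> = count (image_mset snd N) \<mu>"
    by (simp add: \<open>mset_set A = N\<close>)
qed


section \<open>Functions with zero sum\<close>

definition zero_sum :: "'a set \<Rightarrow> ('a \<Rightarrow> real) set" where
  "zero_sum V = {f \<in> functions_on V. sum f V = 0}"

lemma zero_sum_outside: "f \<in> zero_sum V \<Longrightarrow> v \<notin> V \<Longrightarrow> f v = 0"
  by (simp add: zero_sum_def functions_on_def)

text \<open>
  Up to a scalar, the only function of sum zero on \<open>V \<union> S\<close> that is constant on \<open>V\<close> and on \<open>S\<close>
  (for disjoint and nonempty \<open>V\<close> and \<open>S\<close>).
\<close>

definition balance :: "'a set \<Rightarrow> 'a set \<Rightarrow> 'a \<Rightarrow> real" where
  "balance V S = fun_scale (real (card S)) (indicator V) - fun_scale (real (card V)) (indicator S)"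

lemma balance_apply:
  assumes "V \<inter> S = {}"
  shows "v \<in> V \<Longrightarrow> balance V S v = real (card S)" "v \<in> S \<Longrightarrow> balance V S v = - real (card V)"
    "v \<notin> V \<union> S \<Longrightarrow> balance V S v = 0"
  using assms by (auto simp: balance_def indicator_def)

lemma zero_sum_mono:
  assumes "V \<subseteq> W" "finite W" shows "zero_sum V \<subseteq> zero_sum W"
proof
  fix f assume f: "f \<in> zero_sum V"
  have "sum f W = sum f V"
    using assms zero_sum_outside[OF f] by (intro sum.mono_neutral_right) auto
  then show "f \<in> zero_sum W"
    using f assms by (auto simp: zero_sum_def functions_on_def)
qed

lemma balance_zero_sum:
  assumes "V \<inter> S = {}" "finite V" "finite S"
  shows "balance V S \<in> zero_sum (V \<union> S)"
  using assms balance_apply[OF assms(1)]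
  by (simp add: zero_sum_def functions_on_def sum.union_disjoint)

text \<open>
  Subtracting a multiple of \<open>balance V S\<close> makes the sum over \<open>V\<close> vanish; since the total sum is
  zero, the sum over \<open>S\<close> then vanishes as well, and the restrictions to \<open>V\<close> and \<open>S\<close> can be
  expanded separately.
\<close>

lemma zero_sum_Un_subset_span:
  assumes disj: "V \<inter> S = {}" and fin: "finite V" "finite S" and ne: "V \<noteq> {}" "S \<noteq> {}"
    and V: "zero_sum V \<subseteq> fun_space.span B" and S: "zero_sum S \<subseteq> fun_space.span C"
  shows "zero_sum (V \<union> S) \<subseteq> fun_space.span (insert (balance V S) (B \<union> C))"
proof
  fix f
  assume f: "f \<in> zero_sum (V \<union> S)"
  let ?T = "fun_space.span (insert (balance V S) (B \<union> C))"
  have pos: "real (card V) > 0" "real (card S) > 0"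
    using fin ne by (simp_all add: card_gt_0_iff)
  define c where "c = sum f V / (real (card V) * real (card S))"
  have sumV: "sum f V = c * real (card S) * real (card V)"
    using pos by (simp add: c_def)
  have sumS: "sum f S = - sum f V"
    using f disj fin by (simp add: zero_sum_def sum.union_disjoint)
  define h where "h = f - fun_scale c (balance V S)"
  define g1 where "g1 = (\<lambda>v. if v \<in> V then h v else 0)"
  define g2 where "g2 = (\<lambda>v. if v \<in> S then h v else 0)"
  have "sum h V = 0"
    using sumV balance_apply[OF disj] by (simp add: h_def sum_subtractf)
  then have "g1 \<in> zero_sum V"
    by (simp add: g1_def zero_sum_def functions_on_def)
  then have "g1 \<in> ?T"
    using V fun_space.span_mono[of B "insert (balance V S) (B \<union> C)"] by blast
  have "sum h S = 0"
    using sumS sumV balance_apply[OF disj] by (simp add: h_def sum_subtractf sum.distrib)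
  then have "g2 \<in> zero_sum S"
    by (simp add: g2_def zero_sum_def functions_on_def)
  then have "g2 \<in> ?T"
    using S fun_space.span_mono[of C "insert (balance V S) (B \<union> C)"] by blast
  have "f = fun_scale c (balance V S) + g1 + g2"
    using disj zero_sum_outside[OF f] balance_apply[OF disj]
    by (auto simp: fun_eq_iff g1_def g2_def h_def)
  moreover have "fun_scale c (balance V S) \<in> ?T"
    by (intro fun_space.span_scale fun_space.span_base) simp
  ultimately show "f \<in> ?T"
    using \<open>g1 \<in> ?T\<close> \<open>g2 \<in> ?T\<close> by (simp add: fun_space.span_add)
qed

text \<open>
  The differences of the indicator functions of the points of \<open>S\<close> and of one fixed point \<open>a\<close>
  span: the coefficient of the difference for \<open>s\<close> is the value at \<open>s\<close>, and the value at \<open>a\<close> is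
  then correct because the sum is zero.
\<close>

lemma zero_sum_spanning_set:
  assumes "finite S" "S \<noteq> {}"
  obtains C where "finite C" "card C + 1 = card S" "C \<subseteq> zero_sum S"
    "zero_sum S \<subseteq> fun_space.span C"
proof -
  obtain a where a: "a \<in> S" using assms by auto
  define e :: "'a \<Rightarrow> 'a \<Rightarrow> real" where "e = (\<lambda>s. indicator {s} - indicator {a})"
  define C where "C = e ` (S - {a})"
  have "inj_on e (S - {a})"
    by (auto simp: inj_on_def e_def fun_eq_iff indicator_def split: if_splits)
  then have "card C = card (S - {a})"
    by (simp add: C_def card_image)
  then have "card C + 1 = card S"
    using card_Suc_Diff1[OF assms(1) a] by simp
  moreover have "C \<subseteq> zero_sum S"
  proof -
    have "sum (indicator {s} :: 'a \<Rightarrow> real) S = 1" if "s \<in> S" for s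
      using assms(1) that by (simp add: indicator_def sum.delta)
    then have "sum (e s) S = 0" if "s \<in> S" for s
      using a that by (simp add: e_def sum_subtractf)
    then show ?thesis
      using a by (auto simp: C_def zero_sum_def functions_on_def e_def indicator_def)
  qed
  moreover have "zero_sum S \<subseteq> fun_space.span C"
  proof
    fix f
    assume f: "f \<in> zero_sum S"
    have "f v = (\<Sum>s\<in>S - {a}. f s * e s v)" for v
    proof (cases "v = a")
      case True
      have "(\<Sum>s\<in>S - {a}. f s * e s v) = (\<Sum>s\<in>S - {a}. - f s)"
        using True by (intro sum.cong) (auto simp: e_def)
      also have "\<dots> = f a"
        using f sum.remove[OF assms(1) a, of f] by (simp add: zero_sum_def sum_negf)
      finally show ?thesis using True by simp
    next
      case False
      have "(\<Sum>s\<in>S - {a}. f s * e s v) = (\<Sum>s\<in>S - {a}. if s = v then f v else 0)"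
        using False by (intro sum.cong) (auto simp: e_def)
      then show ?thesis
        using False assms(1) zero_sum_outside[OF f, of v] by (auto simp: sum.delta)
    qed
    then have "f = (\<Sum>s\<in>S - {a}. fun_scale (f s) (e s))"
      unfolding fun_eq_iff sum_fun_apply fun_scale_apply by blast
    also have "\<dots> \<in> fun_space.span C"
      unfolding C_def
      by (intro fun_space.span_sum fun_space.span_scale fun_space.span_base imageI)
    finally show "f \<in> fun_space.span C" .
  qed
  moreover have "finite C"
    using assms(1) by (simp add: C_def)
  ultimately show ?thesis
    using that by blast
qed

section \<open>The spectrum under the building steps\<close>

text \<open>
  \<open>reduced_spectrum G M\<close>: the multiset \<open>M\<close> lists the eigenvalues of \<open>G\<close> on the functions of sum
  zero. Requiring spanning together with the right number of pairs, instead of a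
  basis, avoids disjointness and independence proofs when such families are combined.
\<close>

definition reduced_spectrum :: "'a hypergraph \<Rightarrow> real multiset \<Rightarrow> bool" where
  "reduced_spectrum G M \<longleftrightarrow> (\<exists>N.
     image_mset snd N = M \<and> size N + 1 = card (fst G) \<and>
     zero_sum (fst G) \<subseteq> fun_space.span (fst ` set_mset N) \<and>
     (\<forall>(f, \<mu>)\<in>#N. f \<in> zero_sum (fst G) \<and> laplacian G f = fun_scale \<mu> f))"

lemma laplacian_eq_0_if_constant:
  assumes "hypergraph G" "\<And>u. u \<in> fst G \<Longrightarrow> f u = c" "v \<in> fst G"
  shows "laplacian G f v = 0"
proof -
  have "(\<Sum>u\<in>e. f v - f u) = 0" if "e \<in> snd G" for e
    using that assms by (intro sum.neutral) (auto simp: hypergraph_def)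
  then show ?thesis by (simp add: laplacian_def)
qed

lemma laplacian_eigenfunctionI:
  assumes "hypergraph G" "f \<in> functions_on (fst G)"
    "\<And>v. v \<in> fst G \<Longrightarrow> laplacian G f v = \<mu> * f v"
  shows "laplacian G f = fun_scale \<mu> f"
  using assms laplacian_functions_on[OF assms(1), of f]
  by (force simp: fun_eq_iff functions_on_def)

text \<open>
  The constant functions complete the functions of sum zero to the whole space and contribute
  one more eigenvalue \<open>0\<close>.
\<close>

lemma laplacian_multiplicity_if_reduced_spectrum:
  assumes G: "hypergraph G" and spec: "reduced_spectrum G M"
  shows "laplacian_multiplicity G = count (add_mset 0 M)"
proof -
  let ?V = "fst G"
  have V: "finite ?V" "?V \<noteq> {}" using G by (auto simp: hypergraph_def)
  obtain N where N: "image_mset snd N = M" "size N + 1 = card ?V"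
    "zero_sum ?V \<subseteq> fun_space.span (fst ` set_mset N)"
    "\<forall>(f, \<mu>)\<in>#N. f \<in> zero_sum ?V \<and> laplacian G f = fun_scale \<mu> f"
    using spec by (auto simp: reduced_spectrum_def)
  let ?N = "add_mset (indicator ?V, 0) N"
  have "laplacian_multiplicity G = count (image_mset snd ?N)"
  proof (rule laplacian_multiplicity_eq_count)
    show "functions_on ?V \<subseteq> fun_space.span (fst ` set_mset ?N)"
    proof
      fix f :: "'a \<Rightarrow> real"
      assume f: "f \<in> functions_on ?V"
      define c where "c = sum f ?V / real (card ?V)"
      have "f - fun_scale c (indicator ?V) \<in> zero_sum ?V"
        using f V by (simp add: zero_sum_def functions_on_def c_def sum_subtractf)
      then have "f - fun_scale c (indicator ?V) \<in> fun_space.span (fst ` set_mset ?N)"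
        using N(3) fun_space.span_mono[of "fst ` set_mset N" "fst ` set_mset ?N"] by auto
      moreover have "fun_scale c (indicator ?V) \<in> fun_space.span (fst ` set_mset ?N)"
        by (intro fun_space.span_scale fun_space.span_base) simp
      ultimately show "f \<in> fun_space.span (fst ` set_mset ?N)"
        using fun_space.span_add by fastforce
    qed
  next
    have "laplacian G (indicator ?V) = fun_scale 0 (indicator ?V)"
      by (intro laplacian_eigenfunctionI G)
         (auto simp: functions_on_def laplacian_eq_0_if_constant[OF G, of _ 1])
    then show "f \<in> functions_on ?V \<and> laplacian G f = fun_scale \<mu> f" if "(f, \<mu>) \<in># ?N" for f \<mu>
      using that N(4) by (auto simp: functions_on_def zero_sum_def)
  qed (use V N(2) in auto)
  then show ?thesis using N(1) by simp
qed

lemma reduced_spectrum_initial: "reduced_spectrum ({v}, {}) {#}"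
proof -
  have "zero_sum {v} \<subseteq> {0}"
    by (auto simp: zero_sum_def functions_on_def fun_eq_iff)
  then show ?thesis by (auto simp: reduced_spectrum_def)
qed

text \<open>
  The Laplacian depends on the hyperedges only, so all eigenfunctions remain. The new
  one is constant on \<open>V\<close>, hence on every hyperedge.
\<close>

lemma reduced_spectrum_isolated:
  assumes hyp: "hypergraph (V, E)" and v: "v \<notin> V" and spec: "reduced_spectrum (V, E) M"
  shows "reduced_spectrum (V \<union> {v}, E) (add_mset 0 M)"
proof -
  have V: "finite V" "V \<noteq> {}" using hyp by (auto simp: hypergraph_def)
  have hyp': "hypergraph (V \<union> {v}, E)" using hyp by (auto simp: hypergraph_def)
  have disj: "V \<inter> {v} = {}" using v by simp
  have L: "laplacian (V \<union> {v}, E) f = laplacian (V, E) f" for f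
    by (simp add: fun_eq_iff laplacian_def)
  obtain N where N: "image_mset snd N = M" "size N + 1 = card V"
    "zero_sum V \<subseteq> fun_space.span (fst ` set_mset N)"
    "\<forall>(f, \<mu>)\<in>#N. f \<in> zero_sum V \<and> laplacian (V, E) f = fun_scale \<mu> f"
    using spec by (auto simp: reduced_spectrum_def)
  let ?N = "add_mset (balance V {v}, 0) N"
  have "zero_sum {v} \<subseteq> fun_space.span {}"
    using reduced_spectrum_initial[of v] by (simp add: reduced_spectrum_def)
  then have span: "zero_sum (V \<union> {v}) \<subseteq> fun_space.span (fst ` set_mset ?N)"
    using zero_sum_Un_subset_span[OF disj V(1) _ V(2) _ N(3), of "{}"] by simp
  have "laplacian (V \<union> {v}, E) (balance V {v}) = fun_scale 0 (balance V {v})"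
  proof (rule laplacian_eigenfunctionI[OF hyp'])
    show "balance V {v} \<in> functions_on (fst (V \<union> {v}, E))"
      using balance_zero_sum[OF disj V(1)] by (simp add: zero_sum_def)
    fix u
    have "laplacian (V, E) (balance V {v}) u = 0"
      using laplacian_eq_0_if_constant[OF hyp, of "balance V {v}"] balance_apply(1)[OF disj]
        laplacian_functions_on[OF hyp, of "balance V {v}"]
      by (cases "u \<in> V") (auto simp: functions_on_def)
    then show "laplacian (V \<union> {v}, E) (balance V {v}) u = 0 * balance V {v} u"
      by (simp only: L mult_zero_left)
  qed
  moreover have "zero_sum V \<subseteq> zero_sum (V \<union> {v})"
    using V(1) by (intro zero_sum_mono) auto
  ultimately have "\<forall>(f, \<mu>)\<in>#?N. f \<in> zero_sum (V \<union> {v}) \<and>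
      laplacian (V \<union> {v}, E) f = fun_scale \<mu> f"
    using N(4) balance_zero_sum[OF disj V(1)] unfolding L by auto
  moreover have "size ?N + 1 = card (V \<union> {v})"
    using N(2) V(1) v by simp
  moreover have "image_mset snd ?N = add_mset 0 M"
    using N(1) by simp
  ultimately show ?thesis
    using span unfolding reduced_spectrum_def fst_conv by blast
qed

text \<open>
  A vertex \<open>v\<close> of \<open>V\<close> lies in exactly one new hyperedge, \<open>S \<union> {v}\<close>, and a vertex of \<open>S\<close> in all
  of them and in no old one. Each new hyperedge has \<open>card S + 1\<close> vertices, so its weight is
  \<open>1 / card S\<close>.
\<close>

lemma laplacian_dominate:
  assumes hyp: "hypergraph (V, E)" and S: "finite S" "S \<noteq> {}" "S \<inter> V = {}"
  defines "G \<equiv> (V \<union> S, E \<union> {S \<union> {v} | v. v \<in> V})"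
  shows "v \<in> V \<Longrightarrow> laplacian G f v = laplacian (V, E) f v + f v - sum f S / real (card S)"
    and "s \<in> S \<Longrightarrow> laplacian G f s =
      (real (card V) * ((real (card S) + 1) * f s - sum f S) - sum f V) / real (card S)"
proof -
  have fin: "finite V" "finite E"
    using hyp finite_subset[of E "Pow V"] by (auto simp: hypergraph_def)
  have EV: "e \<subseteq> V" if "e \<in> E" for e using hyp that by (auto simp: hypergraph_def)
  have k: "real (card S) > 0" using S by (simp add: card_gt_0_iff)
  have card: "card (S \<union> {v}) = card S + 1" if "v \<in> V" for v
    using S that by (subst card_Un_disjoint) auto
  have sum_edge: "sum g (S \<union> {v}) = sum g S + g v" if "v \<in> V" for v and g :: "'a \<Rightarrow> real"
    using S that by (subst sum.union_disjoint) auto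
  show "laplacian G f v = laplacian (V, E) f v + f v - sum f S / real (card S)" if v: "v \<in> V"
  proof -
    have "{e \<in> snd G. v \<in> e} = insert (S \<union> {v}) {e \<in> E. v \<in> e}"
      using v S by (auto simp: G_def)
    moreover have "S \<union> {v} \<notin> E" using S EV by fastforce
    ultimately have "laplacian G f v = laplacian (V, E) f v
        + 1 / (real (card (S \<union> {v})) - 1) * (\<Sum>u\<in>S \<union> {v}. f v - f u)"
      using fin by (simp add: laplacian_def)
    also have "1 / (real (card (S \<union> {v})) - 1) * (\<Sum>u\<in>S \<union> {v}. f v - f u)
        = f v - sum f S / real (card S)"
      using k by (simp only: card[OF v] sum_edge[OF v]) (simp add: sum_subtractf field_simps)
    finally show ?thesis by simp
  qed
  show "laplacian G f s =
      (real (card V) * ((real (card S) + 1) * f s - sum f S) - sum f V) / real (card S)"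
    if s: "s \<in> S"
  proof -
    have "{e \<in> snd G. s \<in> e} = (\<lambda>v. S \<union> {v}) ` V"
      using s S EV by (auto simp: G_def)
    moreover have "inj_on (\<lambda>v. S \<union> {v}) V"
      using S by (auto simp: inj_on_def)
    ultimately have "laplacian G f s
        = (\<Sum>v\<in>V. 1 / (real (card (S \<union> {v})) - 1) * (\<Sum>u\<in>S \<union> {v}. f s - f u))"
      unfolding laplacian_def by (simp only: sum.reindex o_def)
    also have "\<dots> = (\<Sum>v\<in>V. ((real (card S) + 1) * f s - sum f S - f v) / real (card S))"
    proof (rule sum.cong)
      fix v assume v: "v \<in> V"
      show "1 / (real (card (S \<union> {v})) - 1) * (\<Sum>u\<in>S \<union> {v}. f s - f u)
          = ((real (card S) + 1) * f s - sum f S - f v) / real (card S)"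
        by (simp only: card[OF v] sum_edge[OF v]) (use k in \<open>simp add: sum_subtractf field_simps\<close>)
    qed simp
    also have "\<dots> = (real (card V) * ((real (card S) + 1) * f s - sum f S) - sum f V) / real (card S)"
      by (simp add: sum_subtractf flip: sum_divide_distrib)
    finally show ?thesis .
  qed
qed


text \<open>
  The three kinds of eigenfunctions of the new hypergraph are the old ones extended by zero, the
  functions of sum zero on \<open>S\<close>, and \<open>balance V S\<close>.
\<close>

lemma reduced_spectrum_dominate:
  fixes V S :: "'a set"
  assumes hyp: "hypergraph (V, E)" and S: "finite S" "card S = k" "1 \<le> k" "S \<inter> V = {}"
    and n: "card V = n" and spec: "reduced_spectrum (V, E) M"
  shows "reduced_spectrum (V \<union> S, E \<union> {S \<union> {v} | v. v \<in> V})
    (image_mset (\<lambda>\<mu>. \<mu> + 1) M + {# real (n + k) / real k #}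
      + replicate_mset (k - 1) (real n * (real k + 1) / real k))"
proof -
  define G where "G = (V \<union> S, E \<union> {S \<union> {v} | v. v \<in> V})"
  have V: "finite V" "V \<noteq> {}" using hyp by (auto simp: hypergraph_def)
  have S': "S \<noteq> {}" "real k > 0" "V \<inter> S = {}" using S by auto
  have "2 \<le> card (S \<union> {v})" if "v \<in> V" for v
    using S that by (subst card_Un_disjoint) auto
  then have hypG: "hypergraph G"
    using hyp S by (auto simp: hypergraph_def G_def)
  note L = laplacian_dominate[OF hyp S(1) S'(1) S(4), folded G_def, unfolded S(2) n]
  have sub: "zero_sum V \<subseteq> zero_sum (V \<union> S)" "zero_sum S \<subseteq> zero_sum (V \<union> S)"
    using V(1) S(1) by (simp_all add: zero_sum_mono)
  have eigenI: "laplacian G f = fun_scale \<mu> f"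
    if "f \<in> zero_sum (V \<union> S)" "\<And>v. v \<in> V \<union> S \<Longrightarrow> laplacian G f v = \<mu> * f v" for f \<mu>
    using that by (intro laplacian_eigenfunctionI[OF hypG]) (auto simp: G_def zero_sum_def)
  obtain N where N: "image_mset snd N = M" "size N + 1 = n"
    "zero_sum V \<subseteq> fun_space.span (fst ` set_mset N)"
    "\<forall>(f, \<mu>)\<in>#N. f \<in> zero_sum V \<and> laplacian (V, E) f = fun_scale \<mu> f"
    using spec n by (auto simp: reduced_spectrum_def)
  obtain C where C: "finite C" "card C + 1 = k" "C \<subseteq> zero_sum S"
    "zero_sum S \<subseteq> fun_space.span C"
    using zero_sum_spanning_set[OF S(1) S'(1)] S(2) by metis
  define \<alpha> \<beta> where "\<alpha> = real n * (real k + 1) / real k" and "\<beta> = real (n + k) / real k"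
  let ?b = "balance V S"
  let ?N = "image_mset (\<lambda>(f, \<mu>). (f, \<mu> + 1)) N + image_mset (\<lambda>g. (g, \<alpha>)) (mset_set C)
    + {#(?b, \<beta>)#}"
  have old: "laplacian G f = fun_scale (\<mu> + 1) f" if "(f, \<mu>) \<in># N" for f \<mu>
  proof -
    have f: "f \<in> zero_sum V" "laplacian (V, E) f = fun_scale \<mu> f"
      using N(4) that by auto
    have "f s = 0" if "s \<in> S" for s
      using that zero_sum_outside[OF f(1)] S(4) by auto
    moreover have "sum f V = 0" using f(1) by (simp add: zero_sum_def)
    ultimately show ?thesis
      using f sub(1) by (intro eigenI) (auto simp: L algebra_simps)
  qed
  have new: "laplacian G g = fun_scale \<alpha> g" if "g \<in> C" for g
  proof -
    have g: "g \<in> zero_sum S" using C(3) that by auto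
    have "g v = 0" if "v \<in> V" for v
      using that zero_sum_outside[OF g] S(4) by auto
    moreover have "laplacian (V, E) g v = 0" if "v \<in> V" for v
      using that calculation by (intro laplacian_eq_0_if_constant[OF hyp, of _ 0]) auto
    moreover have "sum g S = 0" using g by (simp add: zero_sum_def)
    ultimately show ?thesis
      using g sub(2) by (intro eigenI) (auto simp: L \<alpha>_def)
  qed
  have mixed: "laplacian G ?b = fun_scale \<beta> ?b"
  proof (rule eigenI)
    show "?b \<in> zero_sum (V \<union> S)"
      by (rule balance_zero_sum[OF S'(3) V(1) S(1)])
    have b: "\<And>v. v \<in> V \<Longrightarrow> ?b v = real k" "\<And>s. s \<in> S \<Longrightarrow> ?b s = - real n"
      using balance_apply[OF S'(3)] S(2) n by auto
    have sums: "sum ?b V = real n * real k" "sum ?b S = - (real k * real n)"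
      using b S(2) n by simp_all
    fix v assume "v \<in> V \<union> S"
    then show "laplacian G ?b v = \<beta> * ?b v"
    proof
      assume v: "v \<in> V"
      have "laplacian (V, E) ?b v = 0"
        using b(1) v by (intro laplacian_eq_0_if_constant[OF hyp]) auto
      then show ?thesis
        using v S'(2) by (simp add: L b sums S(2) \<beta>_def field_simps)
    next
      assume v: "v \<in> S"
      then show ?thesis
        using S'(2) by (simp add: L b sums S(2) n \<beta>_def field_simps)
    qed
  qed
  have "reduced_spectrum G (image_mset snd ?N)"
    unfolding reduced_spectrum_def
  proof (intro exI[of _ ?N] conjI)
    show "size ?N + 1 = card (fst G)"
      using N(2) C(1,2) S(1,2) V(1) S'(3) n by (simp add: G_def card_Un_disjoint)
    have "fst ` set_mset ?N = insert ?b (fst ` set_mset N \<union> C)"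
      using C(1) by (force simp: image_iff)
    then show "zero_sum (fst G) \<subseteq> fun_space.span (fst ` set_mset ?N)"
      using zero_sum_Un_subset_span[OF S'(3) V(1) S(1) V(2) S'(1) N(3) C(4)] by (simp add: G_def)
    have "f \<in> zero_sum (V \<union> S) \<and> laplacian G f = fun_scale \<mu> f" if "(f, \<mu>) \<in># ?N" for f \<mu>
    proof -
      consider "(f, \<mu> - 1) \<in># N" | "f \<in> C" "\<mu> = \<alpha>" | "f = ?b" "\<mu> = \<beta>"
        using \<open>(f, \<mu>) \<in># ?N\<close> C(1) by auto
      then show ?thesis
      proof cases
        case 1
        then show ?thesis using old[OF 1] N(4) sub(1) by auto
      next
        case 2
        then show ?thesis using new C(3) sub(2) by blast
      next
        case 3
        then show ?thesis using mixed balance_zero_sum[OF S'(3) V(1) S(1)] by simp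
      qed
    qed
    moreover have "fst G = V \<union> S" by (simp add: G_def)
    ultimately show "\<forall>(f, \<mu>)\<in>#?N. f \<in> zero_sum (fst G) \<and> laplacian G f = fun_scale \<mu> f"
      by (simp only:) blast
  qed simp
  moreover have "image_mset snd ?N = image_mset (\<lambda>\<mu>. \<mu> + 1) M + {#\<beta>#} + replicate_mset (k - 1) \<alpha>"
  proof -
    have "card C = k - 1" using C(2) by simp
    moreover have "image_mset snd (image_mset (\<lambda>(f, \<mu>). (f, \<mu> + 1)) N) = image_mset (\<lambda>\<mu>. \<mu> + 1) M"
      unfolding N(1)[symmetric] by (simp add: multiset.map_comp comp_def case_prod_beta)
    moreover have "image_mset snd (image_mset (\<lambda>g. (g, \<alpha>)) (mset_set C)) = replicate_mset (card C) \<alpha>"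
      by (simp add: multiset.map_comp comp_def image_mset_const_eq)
    ultimately show ?thesis
      by (simp only: image_mset_union image_mset_single snd_conv union_ac)
  qed
  ultimately have "reduced_spectrum G
      (image_mset (\<lambda>\<mu>. \<mu> + 1) M + {#\<beta>#} + replicate_mset (k - 1) \<alpha>)"
    by (simp only:)
  then show ?thesis
    unfolding G_def \<alpha>_def \<beta>_def .
qed

section \<open>Reading a threshold string\<close>

inductive_cases threshold_build_NilE: "threshold_build [] G"
inductive_cases threshold_build_snocE: "threshold_build (w @ [x]) G"

lemma threshold_build_snoc_IsolatedE:
  assumes "threshold_build (w @ [Isolated]) G" "w \<noteq> []"
  obtains V E v where "threshold_build w (V, E)" "v \<notin> V" "G = (V \<union> {v}, E)"
proof (rule threshold_build_snocE[OF assms(1)])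
  fix V E v
  assume "G = (insert v V, E)" "threshold_build w (V, E)" "v \<notin> V"
  then show ?thesis by (intro that[of V E v]) simp_all
qed (use assms(2) in simp_all)

lemma threshold_build_snoc_DominateE:
  assumes "threshold_build (w @ [Dominate k]) G"
  obtains V E S where "threshold_build w (V, E)" "finite S" "card S = k" "1 \<le> k" "S \<inter> V = {}"
    "G = (V \<union> S, E \<union> {S \<union> {v} | v. v \<in> V})"
proof (rule threshold_build_snocE[OF assms])
  fix V E S
  assume "Dominate k = Dominate (card S)" "G = (V \<union> S, E \<union> {insert v S | v. v \<in> V})"
    "threshold_build w (V, E)" "finite S" "Suc 0 \<le> card S" "S \<inter> V = {}"
  then show ?thesis by (intro that[of V E S]) simp_all
qed simp_all

lemma threshold_build_replicate:
  assumes "threshold_build (w @ replicate r Isolated) G" "w \<noteq> []"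
    and "\<And>H :: 'a hypergraph. threshold_build w H \<Longrightarrow> card (fst H) = n \<and> reduced_spectrum H M"
  shows "card (fst (G :: 'a hypergraph)) = n + r \<and> reduced_spectrum G (M + replicate_mset r 0)"
  using assms(1)
proof (induction r arbitrary: G)
  case 0
  then show ?case using assms(3) by simp
next
  case (Suc r)
  have "threshold_build ((w @ replicate r Isolated) @ [Isolated]) G"
    using Suc.prems by (simp add: replicate_append_same)
  then obtain V E v where G: "threshold_build (w @ replicate r Isolated) (V, E)" "v \<notin> V"
    "G = (V \<union> {v}, E)"
    using assms(2) by (elim threshold_build_snoc_IsolatedE) simp_all
  have "hypergraph (V, E)" using threshold_build_hypergraph[OF G(1)] .
  moreover have "finite V" using calculation by (simp add: hypergraph_def)
  moreover have V: "card V = n + r" "reduced_spectrum (V, E) (M + replicate_mset r 0)"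
    using Suc.IH[OF G(1)] by simp_all
  ultimately show ?case
    using reduced_spectrum_isolated[OF _ G(2) V(2)] G(2,3) by simp
qed

lemma threshold_build_Dominate:
  assumes "threshold_build (w @ [Dominate k]) G"
    and "\<And>H :: 'a hypergraph. threshold_build w H \<Longrightarrow> card (fst H) = n \<and> reduced_spectrum H M"
  shows "card (fst (G :: 'a hypergraph)) = n + k \<and>
    reduced_spectrum G (image_mset (\<lambda>\<mu>. \<mu> + 1) M + {# real (n + k) / real k #}
      + replicate_mset (k - 1) (real n * (real k + 1) / real k))"
proof -
  obtain V E S where G: "threshold_build w (V, E)" "finite S" "card S = k" "1 \<le> k" "S \<inter> V = {}"
    "G = (V \<union> S, E \<union> {S \<union> {v} | v. v \<in> V})"
    by (rule threshold_build_snoc_DominateE[OF assms(1)])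
  have hyp: "hypergraph (V, E)" using threshold_build_hypergraph[OF G(1)] .
  then have card: "card (V \<union> S) = card V + card S"
    using G by (intro card_Un_disjoint) (auto simp: hypergraph_def)
  have V: "card V = n" "reduced_spectrum (V, E) M" using assms(2)[OF G(1)] by simp_all
  show ?thesis
    unfolding G(6) fst_conv card V(1) G(3)
    using reduced_spectrum_dominate[OF hyp G(2-5) V] by blast
qed

lemma image_mset_sum: "image_mset f (\<Sum>i\<in>I. g i) = (\<Sum>i\<in>I. image_mset f (g i))"
  by (induction I rule: infinite_finite_induct) auto

text \<open>
  All three sums in the list of eigenvalues have the form \<open>x i + d - i\<close>, where \<open>x i\<close> is the value
  right after the \<open>i\<close>-th domination. Passing from \<open>d\<close> to \<open>d + 1\<close> therefore
  shifts the existing terms by \<open>1\<close> and appends the last one unshifted.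
\<close>

lemma sum_replicate_mset_shift:
  fixes x :: "nat \<Rightarrow> real"
  assumes "a \<le> Suc d"
  shows "(\<Sum>i=a..Suc d. replicate_mset (r i) (x i + real (Suc d) - real i))
    = image_mset (\<lambda>\<mu>. \<mu> + 1) (\<Sum>i=a..d. replicate_mset (r i) (x i + real d - real i))
      + replicate_mset (r (Suc d)) (x (Suc d))"
proof -
  have "x i + real (Suc d) - real i = (x i + real d - real i) + 1" for i
    by simp
  then show ?thesis
    using assms by (simp only: image_mset_sum image_replicate_mset sum.cl_ivl_Suc) simp
qed

definition threshold_order :: "(nat \<Rightarrow> nat) \<Rightarrow> (nat \<Rightarrow> nat) \<Rightarrow> nat \<Rightarrow> nat" where
  "threshold_order m k d = (\<Sum>j=1..d. m j) + (\<Sum>j=1..d. k j)"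

text \<open>
  The claimed eigenvalues without the \<open>0\<close> of the constant functions. For \<open>d = 0\<close> only the
  \<open>m 1 - 1\<close> zeros remain, which is the list for \<open>m 1\<close> isolated vertices; so the first
  domination obeys the same recursion as the later ones.
\<close>

definition threshold_spectrum :: "(nat \<Rightarrow> nat) \<Rightarrow> (nat \<Rightarrow> nat) \<Rightarrow> nat \<Rightarrow> real multiset" where
  "threshold_spectrum m k d =
     (\<Sum>i=2..d. replicate_mset (m i) (1 + real d - real i))
     + replicate_mset (m 1 - 1) (real d)
     + (\<Sum>i=1..d. {# real (threshold_order m k i) / real (k i) + real d - real i #})
     + (\<Sum>i=1..d. replicate_mset (k i - 1)
          (real (threshold_order m k (i - 1) + m i) * (real (k i) + 1) / real (k i) + real d - real i))"

lemma threshold_order_Suc: "threshold_order m k (Suc d) = threshold_order m k d + m (Suc d) + k (Suc d)"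
  by (simp add: threshold_order_def)

lemma threshold_string_Suc:
  "threshold_string (Suc d) m k
     = (threshold_string d m k @ replicate (m (Suc d)) Isolated) @ [Dominate (k (Suc d))]"
  by (simp add: threshold_string_def)

text \<open>
  The zeros \<open>Z\<close> come from the isolated vertices in front of the last domination, at which point
  the hypergraph has \<open>n\<close> vertices. For \<open>d = 0\<close> these vertices are the initial ones, whose zeros
  \<open>threshold_spectrum m k 0\<close> already contains.
\<close>

lemma threshold_spectrum_Suc:
  fixes m k :: "nat \<Rightarrow> nat" and d :: nat
  defines "n \<equiv> threshold_order m k d + m (Suc d)" and "\<kappa> \<equiv> k (Suc d)"
  defines "Z \<equiv> (if d = 0 then {#} else replicate_mset (m (Suc d)) 0)"
  shows "threshold_spectrum m k (Suc d) = image_mset (\<lambda>\<mu>. \<mu> + 1) (threshold_spectrum m k d + Z)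
    + {# real (n + \<kappa>) / real \<kappa> #} + replicate_mset (\<kappa> - 1) (real n * (real \<kappa> + 1) / real \<kappa>)"
proof -
  have iso: "(\<Sum>i=2..Suc d. replicate_mset (m i) (1 + real (Suc d) - real i))
    = image_mset (\<lambda>\<mu>. \<mu> + 1) ((\<Sum>i=2..d. replicate_mset (m i) (1 + real d - real i)) + Z)"
    using sum_replicate_mset_shift[of 2 d m "\<lambda>_. 1"] by (simp add: Z_def del: of_nat_Suc)
  have one: "{#y#} = replicate_mset 1 y" for y :: real
    by simp
  have order: "threshold_order m k (Suc d) = n + \<kappa>" "threshold_order m k (Suc d - 1) + m (Suc d) = n"
    by (simp_all add: threshold_order_Suc n_def \<kappa>_def)
  have base: "replicate_mset (m 1 - 1) (real (Suc d))
      = image_mset (\<lambda>\<mu>. \<mu> + 1) (replicate_mset (m 1 - 1) (real d))"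
    by (simp add: add.commute)
  have le: "1 \<le> Suc d" by simp
  show ?thesis
    unfolding threshold_spectrum_def iso base one sum_replicate_mset_shift[OF le] order
      \<kappa>_def[symmetric]
    by (simp add: ac_simps)
qed

lemma threshold_build_isolated_vertices:
  assumes "threshold_build (replicate r Isolated) G" "1 \<le> r"
  shows "card (fst (G :: 'a hypergraph)) = r \<and> reduced_spectrum G (replicate_mset (r - 1) 0)"
proof -
  have "replicate r Isolated = [Isolated] @ replicate (r - 1) Isolated"
    using assms(2) by (cases r) auto
  then have build: "threshold_build ([Isolated] @ replicate (r - 1) Isolated) G"
    using assms(1) by simp
  have "card (fst H) = 1 \<and> reduced_spectrum H {#}"
    if "threshold_build [Isolated] H" for H :: "'a hypergraph"
  proof -
    have "threshold_build ([] @ [Isolated]) H" using that by simp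
    then show ?thesis
    proof (rule threshold_build_snocE)
      fix v assume "H = ({v}, {})"
      then show ?thesis by (simp add: reduced_spectrum_initial)
    qed (auto elim: threshold_build_NilE)
  qed
  from threshold_build_replicate[OF build _ this] show ?thesis
    using assms(2) by simp
qed

lemma threshold_reduced_spectrum:
  fixes G :: "'a hypergraph" and m k :: "nat \<Rightarrow> nat"
  assumes "1 \<le> m 1"
  shows "threshold_build (threshold_string (Suc d) m k) G \<Longrightarrow>
    card (fst G) = threshold_order m k (Suc d) \<and>
    reduced_spectrum G (threshold_spectrum m k (Suc d))"
proof (induction d arbitrary: G)
  case 0
  have build: "threshold_build (replicate (m 1) Isolated @ [Dominate (k 1)]) G"
    using 0 by (simp add: threshold_string_def)
  have start: "threshold_order m k 0 = 0"
      "threshold_spectrum m k 0 = replicate_mset (m 1 - 1) 0"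
    by (simp_all add: threshold_order_def threshold_spectrum_def)
  show ?case
    using threshold_build_Dominate[OF build threshold_build_isolated_vertices[OF _ assms]]
    unfolding threshold_spectrum_Suc threshold_order_Suc start by simp
next
  case (Suc d)
  let ?w = "threshold_string (Suc d) m k" and ?r = "m (Suc (Suc d))"
  have "?w \<noteq> []" by (simp add: threshold_string_Suc)
  then have "card (fst H) = threshold_order m k (Suc d) + ?r \<and>
      reduced_spectrum H (threshold_spectrum m k (Suc d) + replicate_mset ?r 0)"
    if "threshold_build (?w @ replicate ?r Isolated) H" for H :: "'a hypergraph"
    using threshold_build_replicate[OF that _ Suc.IH] by blast
  from threshold_build_Dominate[OF Suc.prems[unfolded threshold_string_Suc[of "Suc d"]] this]
  show ?case
    unfolding threshold_spectrum_Suc[of m k "Suc d"] threshold_order_Suc[of m k "Suc d"]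
    by simp
qed

theorem theorem1p2:
  fixes G :: "'a hypergraph" and d :: nat and m k :: "nat \<Rightarrow> nat"
  assumes "1 \<le> d"
    and "\<forall>i\<in>{1..d}. 1 \<le> k i"
    and "1 \<le> m 1"
    and "threshold_build (threshold_string d m k) G"
  shows "laplacian_multiplicity G = count
      ({#0#}
       + (\<Sum>i=2..d. replicate_mset (m i) (real d - real i + 1))
       + replicate_mset (m 1 - 1) (real d)
       + (\<Sum>i=1..d. {# 1 / real (k i) * ((\<Sum>j=1..i. real (m j)) + (\<Sum>j=1..i. real (k j)))
                        + real d - real i #})
       + (\<Sum>i=1..d. replicate_mset (k i - 1)
            ((real (k i) + 1) / real (k i)
               * ((\<Sum>j=1..i. real (m j)) + (\<Sum>j=1..i - 1. real (k j)))
             + real d - real i)))"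
proof -
  have "threshold_build (threshold_string (Suc (d - 1)) m k) G"
    using assms(1,4) by simp
  from threshold_reduced_spectrum[where m = m and k = k and d = "d - 1", OF assms(3) this]
  have "reduced_spectrum G (threshold_spectrum m k d)"
    using assms(1) by simp
  then have mult: "laplacian_multiplicity G = count (add_mset 0 (threshold_spectrum m k d))"
    using laplacian_multiplicity_if_reduced_spectrum threshold_build_hypergraph[OF assms(4)]
    by blast
  have iso: "real d - real i + 1 = 1 + real d - real i" for i
    by simp
  have mixed: "1 / real (k i) * ((\<Sum>j=1..i. real (m j)) + (\<Sum>j=1..i. real (k j)))
      = real (threshold_order m k i) / real (k i)" for i
    by (simp add: threshold_order_def)
  have at_step: "(real (k i) + 1) / real (k i)
        * ((\<Sum>j=1..i. real (m j)) + (\<Sum>j=1..i - 1. real (k j)))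
      = real (threshold_order m k (i - 1) + m i) * (real (k i) + 1) / real (k i)"
    if "i \<in> {1..d}" for i
    using that by (cases i) (simp_all add: threshold_order_def)
  have new: "(\<Sum>i=1..d. replicate_mset (k i - 1) ((real (k i) + 1) / real (k i)
        * ((\<Sum>j=1..i. real (m j)) + (\<Sum>j=1..i - 1. real (k j))) + real d - real i))
    = (\<Sum>i=1..d. replicate_mset (k i - 1)
        (real (threshold_order m k (i - 1) + m i) * (real (k i) + 1) / real (k i)
          + real d - real i))"
    by (intro sum.cong refl) (simp only: at_step)
  show ?thesis
    unfolding mult threshold_spectrum_def iso mixed new
    by (simp add: ac_simps)
qed

end
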